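(* There is a deterministic algorithm for $k$-median that, given a weighted metric space $(V,w,d)$ of size $n$ and an integer $1\le k\le n$, computes an $O(\log(n/k))$-approximate solution (a set $S\subseteq V$, $|S|\le k$, with $\mathrm{cost}(S)\le O(\log(n/k))\cdot\mathrm{OPT}_k(V)$) using $\tilde O(nk)$ queries to the distance function $d$ (its running time may be exponential).
   Context: A weighted metric space $(V,w,d)$: finite set $V$, weights $w:V\to\mathbb{R}_{\ge0}$, metric $d$. For $S,U\subseteq V$, $d(x,S)=\min_{y\in S}d(x,y)$, $\mathrm{cost}(S,U)=\sum_{x\in U}w(x)d(x,S)$, $\mathrm{cost}(S)=\mathrm{cost}(S,V)$, and $\mathrm{OPT}_k(U)=\min_{S\subseteq U,|S|=k}\mathrm{cost}(S,U)$. The algorithm learns about $d$ only by querying values $d(x,y)$; its query complexity is the number of such queries. $\tilde O(\cdot)$ hides factors polylogarithmic in $n$ and the aspect ratio. *)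

theory Defs
  imports "HOL-Analysis.Abstract_Metric_Spaces"
begin

locale weighted_metric_space = Metric_space V d
  for V :: "'a set" and w :: "'a \<Rightarrow> real" and d :: "'a \<Rightarrow> 'a \<Rightarrow> real" +
  assumes finite_space: "finite V"
    and weight_nonneg: "x \<in> V \<Longrightarrow> 0 \<le> w x"

text \<open>Only meaningful for finite nonempty \<open>S\<close>, as \<open>Min {}\<close> is unspecified.\<close>

definition dist_set :: "('a \<Rightarrow> 'a \<Rightarrow> real) \<Rightarrow> 'a \<Rightarrow> 'a set \<Rightarrow> real" where
  "dist_set d x S = Min ((\<lambda>y. d x y) ` S)"

definition cost :: "('a \<Rightarrow> real) \<Rightarrow> ('a \<Rightarrow> 'a \<Rightarrow> real) \<Rightarrow> 'a set \<Rightarrow> 'a set \<Rightarrow> real" where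
  "cost w d S U = (\<Sum>x\<in>U. w x * dist_set d x S)"

definition OPT :: "('a \<Rightarrow> real) \<Rightarrow> ('a \<Rightarrow> 'a \<Rightarrow> real) \<Rightarrow> nat \<Rightarrow> 'a set \<Rightarrow> real" where
  "OPT w d k U = Min ((\<lambda>S. cost w d S U) ` {S. S \<subseteq> U \<and> card S = k})"

text \<open>The one-point space, which has no nonzero distances, gets aspect ratio 1.\<close>

definition aspect_ratio :: "'a set \<Rightarrow> ('a \<Rightarrow> 'a \<Rightarrow> real) \<Rightarrow> real" where
  "aspect_ratio V d =
    (let D = {d x y | x y. x \<in> V \<and> y \<in> V \<and> x \<noteq> y} in
     if D = {} then 1 else Max D / Min D)"

text \<open>
  A deterministic computation with oracle access to a distance function, as an adaptive decision
  tree: \<open>Query x y f\<close> asks for \<open>d x y\<close> and continues with \<open>f (d x y)\<close>. Computation between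
  queries is free; only oracle calls are counted, each repetition included.
\<close>

datatype 'a query_alg = Output "'a set" | Query 'a 'a "real \<Rightarrow> 'a query_alg"

primrec run :: "('a \<Rightarrow> 'a \<Rightarrow> real) \<Rightarrow> 'a query_alg \<Rightarrow> 'a set" where
  "run d (Output S) = S"
| "run d (Query x y f) = run d (f (d x y))"

primrec queries :: "('a \<Rightarrow> 'a \<Rightarrow> real) \<Rightarrow> 'a query_alg \<Rightarrow> ('a \<times> 'a) list" where
  "queries d (Output S) = []"
| "queries d (Query x y f) = (x, y) # queries d (f (d x y))"

text \<open>
  \<open>O(log (n/k))\<close> is read as \<open>C * (1 + ln (n/k))\<close>: the bare \<open>C * ln (n/k)\<close> is below 1 for \<open>k\<close> close
  to \<open>n\<close>, where no solution can achieve it.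
\<close>

definition approximates_k_median ::
    "real \<Rightarrow> 'a set \<Rightarrow> ('a \<Rightarrow> real) \<Rightarrow> ('a \<Rightarrow> 'a \<Rightarrow> real) \<Rightarrow> nat \<Rightarrow> 'a set \<Rightarrow> bool" where
  "approximates_k_median C V w d k S \<longleftrightarrow>
     S \<subseteq> V \<and> S \<noteq> {} \<and> card S \<le> k \<and>
     cost w d S V \<le> C * (1 + ln (real (card V) / real k)) * OPT w d k V"

text \<open>
  The bound soft-O of \<open>n k\<close>, with \<open>(1 + ln n + ln \<Delta>) ^ c\<close> as the hidden factor polylogarithmic in
  \<open>n\<close> and the aspect ratio \<open>\<Delta>\<close>.
\<close>

definition soft_nk_bound :: "real \<Rightarrow> nat \<Rightarrow> 'a set \<Rightarrow> ('a \<Rightarrow> 'a \<Rightarrow> real) \<Rightarrow> nat \<Rightarrow> real" where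
  "soft_nk_bound C c V d k =
     C * real (card V) * real k * (1 + ln (real (card V)) + ln (aspect_ratio V d)) ^ c"

end

theory Submission
  imports Defs
begin

text \<open>
  Split the points recursively into halves until the parts have at most \<open>k\<close> points; such a part is
  its own solution, of cost 0. To merge two parts with solutions \<open>A\<close> and \<open>B\<close>, query all distances
  from the merged part \<open>U\<close> to \<open>A \<union> B\<close> and keep the best \<open>k\<close> centers inside \<open>A \<union> B\<close>. Projecting an
  optimal solution \<open>R\<close> of the whole space onto \<open>A \<union> B\<close> shows that the merge raises the cost on \<open>U\<close>
  by at most \<open>2 * cost R U\<close>. These increases are additive over the levels, and on one level they
  sum to twice the optimum, so \<open>O(log (n/k))\<close> levels lose a factor \<open>O(log (n/k))\<close>, with at most
  \<open>2 * n * k\<close> queries on each level.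
\<close>

section \<open>Sequencing of decision trees and batches of queries\<close>

primrec bind :: "'a query_alg \<Rightarrow> ('a set \<Rightarrow> 'a query_alg) \<Rightarrow> 'a query_alg" where
  "bind (Output S) f = f S"
| "bind (Query x y g) f = Query x y (\<lambda>r. bind (g r) f)"

lemma run_bind [simp]: "run d (bind a f) = run d (f (run d a))"
  by (induction a) auto

lemma queries_bind [simp]: "queries d (bind a f) = queries d a @ queries d (f (run d a))"
  by (induction a) auto

text \<open>A batch of queries fixed in advance. The continuation receives only the table of
  answers, so whatever it computes depends on the metric through the queried pairs alone.\<close>

primrec probe ::
    "('a \<times> 'a) list \<Rightarrow> (('a \<Rightarrow> 'a \<Rightarrow> real) \<Rightarrow> 'a query_alg) \<Rightarrow> 'a query_alg" where
  "probe [] f = f (\<lambda>_ _. 0)"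
| "probe (p # ps) f =
     Query (fst p) (snd p) (\<lambda>r. probe ps (\<lambda>g. f (g(fst p := (g (fst p))(snd p := r)))))"

text \<open>The table produced by \<open>probe\<close>. The default 0 outside \<open>P\<close>
  matches the empty table with which \<open>probe\<close> ends.\<close>

definition restrict_dist :: "('a \<times> 'a) set \<Rightarrow> ('a \<Rightarrow> 'a \<Rightarrow> real) \<Rightarrow> 'a \<Rightarrow> 'a \<Rightarrow> real" where
  "restrict_dist P d x y = (if (x, y) \<in> P then d x y else 0)"

lemma restrict_dist_empty: "restrict_dist {} d = (\<lambda>_ _. 0)"
  by (simp add: restrict_dist_def fun_eq_iff)

lemma restrict_dist_insert:
  "restrict_dist (insert (x, y) P) d = (restrict_dist P d)(x := (restrict_dist P d x)(y := d x y))"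
  by (auto simp: restrict_dist_def fun_eq_iff)

lemma run_probe [simp]: "run d (probe ps f) = run d (f (restrict_dist (set ps) d))"
  by (induction ps arbitrary: f) (auto simp: restrict_dist_empty restrict_dist_insert)

lemma queries_probe [simp]:
  "queries d (probe ps f) = ps @ queries d (f (restrict_dist (set ps) d))"
  by (induction ps arbitrary: f) (auto simp: restrict_dist_empty restrict_dist_insert)

text \<open>Only distances from \<open>U\<close> to \<open>S\<close> enter the cost, so the queried
  table suffices to compare all candidates inside \<open>T\<close>.\<close>

lemma cost_restrict_dist:
  assumes "S \<subseteq> T"
  shows "cost w (restrict_dist (U \<times> T) d) S U = cost w d S U"
proof -
  have "dist_set (restrict_dist (U \<times> T) d) x S = dist_set d x S" if "x \<in> U" for x
    unfolding dist_set_def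
    by (intro arg_cong[where f = Min] image_cong) (use that assms in \<open>auto simp: restrict_dist_def\<close>)
  then show ?thesis
    by (simp add: cost_def)
qed

section \<open>Exhaustive search and the recursive algorithm\<close>

text \<open>At most \<open>k\<close> centers rather than exactly \<open>k\<close>, since projecting
  centers may identify some of them. Nonemptiness keeps \<open>dist_set\<close> meaningful.\<close>

definition center_sets :: "nat \<Rightarrow> 'a set \<Rightarrow> 'a set set" where
  "center_sets k T = {S. S \<subseteq> T \<and> S \<noteq> {} \<and> card S \<le> k}"

definition best_centers ::
    "('a \<Rightarrow> real) \<Rightarrow> ('a \<Rightarrow> 'a \<Rightarrow> real) \<Rightarrow> nat \<Rightarrow> 'a set \<Rightarrow> 'a set \<Rightarrow> 'a set" where
  "best_centers w d k T U = arg_min_on (\<lambda>S. cost w d S U) (center_sets k T)"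

lemma best_centers:
  assumes "finite T" "S \<in> center_sets k T"
  shows "best_centers w d k T U \<in> center_sets k T"
    and "cost w d (best_centers w d k T U) U \<le> cost w d S U"
proof -
  have fin: "finite (center_sets k T)"
    using assms(1) by (simp add: center_sets_def)
  have ne: "center_sets k T \<noteq> {}"
    using assms(2) by blast
  show "best_centers w d k T U \<in> center_sets k T"
    unfolding best_centers_def by (rule arg_min_if_finite(1)[OF fin ne])
  show "cost w d (best_centers w d k T U) U \<le> cost w d S U"
    unfolding best_centers_def by (rule arg_min_least[OF fin ne assms(2)])
qed

text \<open>Level \<open>j\<close> is meant for lists of length at most \<open>k * 2 ^ j\<close>.
  Cutting at \<open>m\<close>, not in the middle, makes both pieces fit the level below. A distinct
  enumeration of \<open>T\<close> keeps the batch at \<open>length xs * card T\<close>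
  queries.\<close>

primrec solve :: "('a \<Rightarrow> real) \<Rightarrow> nat \<Rightarrow> nat \<Rightarrow> 'a list \<Rightarrow> 'a query_alg" where
  "solve w k 0 xs = Output (set xs)"
| "solve w k (Suc j) xs =
    (let m = k * 2 ^ j in
     if length xs \<le> m then solve w k j xs
     else bind (solve w k j (take m xs)) (\<lambda>A. bind (solve w k j (drop m xs)) (\<lambda>B.
       let T = A \<union> B in
       probe (List.product xs (SOME ts. set ts = T \<and> distinct ts)) (\<lambda>g.
         Output (best_centers w g k T (set xs))))))"

section \<open>Costs of center sets and the loss in one merge\<close>

context weighted_metric_space
begin

lemma dist_set_le: "finite S \<Longrightarrow> s \<in> S \<Longrightarrow> dist_set d x S \<le> d x s"
  by (simp add: dist_set_def)

lemma dist_set_attained: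
  assumes "finite S" "S \<noteq> {}"
  obtains s where "s \<in> S" "dist_set d x S = d x s"
proof -
  have "dist_set d x S \<in> (\<lambda>y. d x y) ` S"
    unfolding dist_set_def using assms by (intro Min_in) auto
  then show thesis
    using that by blast
qed

lemma dist_set_nonneg:
  assumes "finite S" "S \<noteq> {}"
  shows "0 \<le> dist_set d x S"
  using dist_set_attained[OF assms, of x] by (metis nonneg)

lemma dist_set_antimono:
  assumes "S \<subseteq> T" "S \<noteq> {}" "finite T"
  shows "dist_set d x T \<le> dist_set d x S"
  unfolding dist_set_def using assms by (intro Min_antimono) auto

lemma cost_mono_dist:
  assumes "U \<subseteq> V" "\<And>x. x \<in> U \<Longrightarrow> dist_set d x S \<le> dist_set d x T"
  shows "cost w d S U \<le> cost w d T U"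
  unfolding cost_def using assms weight_nonneg by (intro sum_mono mult_left_mono) auto

lemma cost_nonneg:
  assumes "U \<subseteq> V" "finite S" "S \<noteq> {}"
  shows "0 \<le> cost w d S U"
  unfolding cost_def using assms weight_nonneg dist_set_nonneg
  by (intro sum_nonneg mult_nonneg_nonneg) auto

lemma cost_self:
  assumes "U \<subseteq> V"
  shows "cost w d U U = 0"
proof -
  have "finite U"
    using assms finite_space finite_subset by blast
  then have "dist_set d x U = 0" if "x \<in> U" for x
    using dist_set_le[of U x x] dist_set_nonneg[of U x] that assms by (auto simp: subset_iff)
  then show ?thesis
    by (simp add: cost_def)
qed

text \<open>Move each center \<open>r\<close> of \<open>R\<close> to a nearest point
  \<open>p r\<close> of \<open>T\<close>. If \<open>r\<close> and \<open>t\<close> are nearest to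
  \<open>x\<close> in \<open>R\<close> and \<open>T\<close>, then
  \<open>d r (p r) \<le> d r t \<le> d r x + d x t\<close>, so \<open>x\<close> reaches
  \<open>p r\<close> within \<open>d x t + 2 * d x r\<close>.\<close>

lemma projected_centers:
  assumes T: "T \<subseteq> V" "T \<noteq> {}" and R: "R \<in> center_sets k V"
  obtains S where "S \<in> center_sets k T"
    "\<And>x. x \<in> V \<Longrightarrow> dist_set d x S \<le> dist_set d x T + 2 * dist_set d x R"
proof -
  have finT: "finite T" and finR: "finite R" and RV: "R \<subseteq> V" and Rne: "R \<noteq> {}"
    using T(1) R finite_space finite_subset by (auto simp: center_sets_def)
  have "\<exists>t. t \<in> T \<and> dist_set d r T = d r t" for r
    using dist_set_attained[OF finT T(2)] by metis
  then obtain p where p: "\<And>r. p r \<in> T" "\<And>r. dist_set d r T = d r (p r)"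
    by metis
  show thesis
  proof (rule that[of "p ` R"])
    show "p ` R \<in> center_sets k T"
      using p R card_image_le[OF finR, of p] by (auto simp: center_sets_def)
  next
    fix x assume x: "x \<in> V"
    obtain r where r: "r \<in> R" "dist_set d x R = d x r"
      using dist_set_attained[OF finR Rne] by metis
    obtain t where t: "t \<in> T" "dist_set d x T = d x t"
      using dist_set_attained[OF finT T(2)] by metis
    have V: "r \<in> V" "t \<in> V" "p r \<in> V"
      using r t p T RV by auto
    have "dist_set d x (p ` R) \<le> d x (p r)"
      using finR r by (intro dist_set_le) auto
    also have "\<dots> \<le> d x r + d r (p r)"
      using triangle x V by blast
    also have "d r (p r) \<le> d r t"
      using p(2)[of r] dist_set_le[OF finT t(1), of r] by simp
    also have "d r t \<le> d r x + d x t"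
      using triangle x V by blast
    finally show "dist_set d x (p ` R) \<le> dist_set d x T + 2 * dist_set d x R"
      using r t commute[of r x] by simp
  qed
qed

text \<open>The minimizer for the table also minimizes the true cost among candidates in
  \<open>T\<close>, hence beats the projection of \<open>R\<close>. The coefficient 1 of
  \<open>cost w d T U\<close> is what makes losses add up over the levels instead of
  multiplying.\<close>

lemma best_centers_cost:
  assumes T: "T \<subseteq> V" "T \<noteq> {}" and R: "R \<in> center_sets k V" and U: "U \<subseteq> V"
  shows "best_centers w (restrict_dist (U \<times> T) d) k T U \<in> center_sets k T" (is "?B \<in> _")
    and "cost w d (best_centers w (restrict_dist (U \<times> T) d) k T U) U
           \<le> cost w d T U + 2 * cost w d R U"
proof -
  obtain S where S: "S \<in> center_sets k T"
    and dist: "\<And>x. x \<in> V \<Longrightarrow> dist_set d x S \<le> dist_set d x T + 2 * dist_set d x R"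
    using projected_centers[OF T R] by blast
  have finT: "finite T"
    using T finite_space finite_subset by blast
  show B: "?B \<in> center_sets k T"
    by (rule best_centers(1)[OF finT S])
  have "cost w d ?B U \<le> cost w d S U"
    using best_centers(2)[OF finT S, of w "restrict_dist (U \<times> T) d" U] B S
    by (simp add: cost_restrict_dist center_sets_def)
  also have "\<dots> \<le> (\<Sum>x\<in>U. w x * (dist_set d x T + 2 * dist_set d x R))"
    unfolding cost_def using U weight_nonneg dist by (intro sum_mono mult_left_mono) auto
  also have "\<dots> = cost w d T U + 2 * cost w d R U"
    by (simp add: cost_def sum.distrib sum_distrib_left algebra_simps)
  finally show "cost w d ?B U \<le> cost w d T U + 2 * cost w d R U" .
qed

text \<open>Every point can keep the center it had in its own part; additional centers only shorten
  distances.\<close>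

lemma cost_Un_le:
  assumes "U \<union> W \<subseteq> V" "U \<inter> W = {}" "A \<subseteq> V" "B \<subseteq> V" "A \<noteq> {}" "B \<noteq> {}"
  shows "cost w d (A \<union> B) (U \<union> W) \<le> cost w d A U + cost w d B W"
proof -
  have fin: "finite U" "finite W" "finite (A \<union> B)"
    using assms finite_space by (auto intro: finite_subset[where B = V])
  have "cost w d (A \<union> B) (U \<union> W) = cost w d (A \<union> B) U + cost w d (A \<union> B) W"
    unfolding cost_def using fin assms by (intro sum.union_disjoint) auto
  also have "\<dots> \<le> cost w d A U + cost w d B W"
    using assms fin by (intro add_mono cost_mono_dist dist_set_antimono) auto
  finally show ?thesis .
qed

text \<open>The competitor \<open>R\<close> ranges over all of \<open>V\<close> and stays fixed
  during the induction, so its costs on the two parts add up to its cost on the whole. Comparing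
  with an optimum of each part would not give this.\<close>

lemma solve_correct:
  assumes "1 \<le> k" "distinct xs" "set xs \<subseteq> V" "xs \<noteq> []" "length xs \<le> k * 2 ^ j"
    and R: "R \<in> center_sets k V"
  shows "run d (solve w k j xs) \<in> center_sets k (set xs) \<and>
    cost w d (run d (solve w k j xs)) (set xs) \<le> 2 * real j * cost w d R (set xs) \<and>
    set (queries d (solve w k j xs)) \<subseteq> set xs \<times> set xs \<and>
    length (queries d (solve w k j xs)) \<le> 2 * j * length xs * k"
  using assms(2-5)
proof (induction j arbitrary: xs)
  case 0
  then show ?case
    by (simp add: center_sets_def distinct_card cost_self)
next
  case (Suc j)
  have finR: "finite R" "R \<noteq> {}"
    using R finite_space finite_subset by (auto simp: center_sets_def)
  define m where "m = k * 2 ^ j"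
  show ?case
  proof (cases "length xs \<le> m")
    case True
    then have run_eq: "solve w k (Suc j) xs = solve w k j xs"
      by (simp add: m_def)
    \<comment> \<open>Skipping a level is harmless: both bounds grow with the level because the cost
      of \<open>R\<close> is nonnegative.\<close>
    have "0 \<le> cost w d R (set xs)"
      using cost_nonneg Suc.prems finR by blast
    then have "2 * real j * cost w d R (set xs) \<le> 2 * real (Suc j) * cost w d R (set xs)"
      by (intro mult_right_mono) auto
    moreover have "2 * j * length xs * k \<le> 2 * Suc j * length xs * k"
      by (intro mult_le_mono) auto
    ultimately show ?thesis
      unfolding run_eq using Suc.IH[OF Suc.prems(1-3)] True m_def by (meson order_trans)
  next
    case False
    define ys where "ys = take m xs"
    define zs where "zs = drop m xs"
    have xs: "xs = ys @ zs"
      by (simp add: ys_def zs_def)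
    \<comment> \<open>Positive \<open>m\<close> makes the first part nonempty;
      \<open>length xs > m\<close> does so for the second, and \<open>length xs \<le> 2 * m\<close>
      bounds its length by \<open>m\<close>.\<close>
    have "0 < m"
      using assms(1) by (simp add: m_def)
    then have ne: "ys \<noteq> []" "zs \<noteq> []" and len: "length ys \<le> m" "length zs \<le> m"
      using False Suc.prems(4) by (auto simp: ys_def zs_def m_def)
    define A where "A = run d (solve w k j ys)"
    define B where "B = run d (solve w k j zs)"
    define T where "T = A \<union> B"
    define ts where "ts = (SOME ts. set ts = T \<and> distinct ts)"
    have A: "A \<in> center_sets k (set ys)" "cost w d A (set ys) \<le> 2 * real j * cost w d R (set ys)"
        "set (queries d (solve w k j ys)) \<subseteq> set ys \<times> set ys"
        "length (queries d (solve w k j ys)) \<le> 2 * j * length ys * k"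
      using Suc.IH[of ys] Suc.prems ne len by (auto simp: xs A_def m_def)
    have B: "B \<in> center_sets k (set zs)" "cost w d B (set zs) \<le> 2 * real j * cost w d R (set zs)"
        "set (queries d (solve w k j zs)) \<subseteq> set zs \<times> set zs"
        "length (queries d (solve w k j zs)) \<le> 2 * j * length zs * k"
      using Suc.IH[of zs] Suc.prems ne len by (auto simp: xs B_def m_def)
    have AB: "A \<subseteq> set ys" "B \<subseteq> set zs" "A \<noteq> {}" "B \<noteq> {}" "card A \<le> k" "card B \<le> k"
      using A(1) B(1) by (auto simp: center_sets_def)
    have T: "T \<subseteq> set xs" "T \<noteq> {}" "T \<subseteq> V" "card T \<le> 2 * k"
      using AB Suc.prems card_Un_le[of A B] by (auto simp: T_def xs)
    have "\<exists>ts. set ts = T \<and> distinct ts"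
      using T(1) finite_distinct_list[of T] finite_subset by blast
    then have ts: "set ts = T" "distinct ts"
      unfolding ts_def by (metis (mono_tags, lifting) someI_ex)+
    have solve_eq: "solve w k (Suc j) xs =
        bind (solve w k j ys) (\<lambda>A. bind (solve w k j zs) (\<lambda>B.
          let T = A \<union> B in
          probe (List.product xs (SOME ts. set ts = T \<and> distinct ts)) (\<lambda>g.
            Output (best_centers w g k T (set xs)))))"
      using False by (simp add: m_def ys_def zs_def Let_def)
    have run_eq: "run d (solve w k (Suc j) xs) =
        best_centers w (restrict_dist (set xs \<times> T) d) k T (set xs)"
      by (simp add: solve_eq Let_def flip: A_def B_def T_def ts_def del: solve.simps)
         (simp add: ts)
    have queries_eq: "queries d (solve w k (Suc j) xs) =
        queries d (solve w k j ys) @ queries d (solve w k j zs) @ List.product xs ts"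
      by (simp add: solve_eq Let_def flip: A_def B_def T_def ts_def del: solve.simps)
    note best = best_centers_cost[OF T(3,2) R Suc.prems(2)]
    have "run d (solve w k (Suc j) xs) \<in> center_sets k (set xs)"
      unfolding run_eq using best(1) T(1) by (auto simp: center_sets_def)
    moreover have "cost w d (run d (solve w k (Suc j) xs)) (set xs)
        \<le> 2 * real (Suc j) * cost w d R (set xs)"
    proof -
      have "cost w d T (set xs) \<le> cost w d A (set ys) + cost w d B (set zs)"
        unfolding T_def xs set_append using AB Suc.prems by (intro cost_Un_le) (auto simp: xs)
      also have "\<dots> \<le> 2 * real j * (cost w d R (set ys) + cost w d R (set zs))"
        using A(2) B(2) by (simp add: algebra_simps)
      also have "cost w d R (set ys) + cost w d R (set zs) = cost w d R (set xs)"
        unfolding cost_def xs set_append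
        using Suc.prems(1) by (intro sum.union_disjoint[symmetric]) (auto simp: xs)
      \<comment> \<open>The merge adds \<open>2 * cost w d R (set xs)\<close>, which raises the
        factor from \<open>2 * j\<close> to \<open>2 * (j + 1)\<close>.\<close>
      finally show ?thesis
        unfolding run_eq using best(2) by (simp add: algebra_simps)
    qed
    moreover have "set (queries d (solve w k (Suc j) xs)) \<subseteq> set xs \<times> set xs"
      using A(3) B(3) T(1) ts(1) unfolding queries_eq by (auto simp: xs)
    moreover have "length (queries d (solve w k (Suc j) xs)) \<le> 2 * Suc j * length xs * k"
    proof -
      have "length ts \<le> 2 * k"
        using ts T(4) distinct_card[of ts] by simp
      then have "length xs * length ts \<le> length xs * (2 * k)"
        by (rule mult_le_mono2)
      \<comment> \<open>The recursive calls sum to \<open>2 * j * length xs * k\<close>, as the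
        parts partition \<open>xs\<close>; the merge contributes one more
        \<open>2 * length xs * k\<close>.\<close>
      then have "length (queries d (solve w k (Suc j) xs))
          \<le> 2 * j * length ys * k + 2 * j * length zs * k + length xs * (2 * k)"
        unfolding queries_eq length_append length_product using A(4) B(4) by linarith
      also have "\<dots> = 2 * Suc j * length xs * k"
        by (simp add: xs algebra_simps)
      finally show ?thesis .
    qed
    ultimately show ?thesis
      by blast
  qed
qed

section \<open>Attainment of the optimum and the range of the aspect ratio\<close>

lemma OPT_attained:
  assumes "1 \<le> k" "k \<le> card V"
  obtains R where "R \<in> center_sets k V" "OPT w d k V = cost w d R V"
proof -
  let ?F = "{S. S \<subseteq> V \<and> card S = k}"
  have "finite ?F"
    using finite_space by simp
  moreover have "?F \<noteq> {}"
    using assms(2) obtain_subset_with_card_n by blast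
  ultimately have "OPT w d k V \<in> (\<lambda>S. cost w d S V) ` ?F"
    unfolding OPT_def by (intro Min_in) auto
  then obtain S where "S \<subseteq> V" "card S = k" "OPT w d k V = cost w d S V"
    by blast
  moreover from this have "S \<noteq> {}"
    using assms(1) by auto
  ultimately show thesis
    using that[of S] by (simp add: center_sets_def)
qed

lemma aspect_ratio_ge_1: "1 \<le> aspect_ratio V d"
proof -
  define D where "D = {d x y | x y. x \<in> V \<and> y \<in> V \<and> x \<noteq> y}"
  have "D \<subseteq> (\<lambda>(x, y). d x y) ` (V \<times> V)"
    by (auto simp: D_def)
  then have fin: "finite D"
    using finite_space by (meson finite_SigmaI finite_imageI finite_subset)
  have pos: "0 < r" if "r \<in> D" for r
    using that by (auto simp: D_def mdist_pos_less)
  have "1 \<le> Max D / Min D" if "D \<noteq> {}"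
    using fin that pos[of "Min D"] Max_ge[OF fin, of "Min D"] by (simp add: le_divide_eq)
  then show ?thesis
    unfolding aspect_ratio_def D_def[symmetric] by (simp add: Let_def)
qed

end

section \<open>The number of levels is logarithmic in \<open>n / k\<close>\<close>

definition depth :: "nat \<Rightarrow> nat \<Rightarrow> nat" where
  "depth n k = nat \<lceil>log 2 (real n / real k)\<rceil>"

lemma le_mult_power_depth:
  assumes "1 \<le> k" "k \<le> n"
  shows "n \<le> k * 2 ^ depth n k"
proof -
  have "real n / real k = 2 powr log 2 (real n / real k)"
    using assms by simp
  also have "\<dots> \<le> 2 powr real (depth n k)"
    by (simp add: depth_def real_nat_ceiling_ge)
  finally have "real n / real k \<le> 2 ^ depth n k"
    by (simp add: powr_realpow)
  then have "real n \<le> real (k * 2 ^ depth n k)"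
    using assms by (simp add: divide_le_eq mult.commute)
  then show ?thesis
    by (rule of_nat_le_iff[THEN iffD1])
qed

text \<open>Rounding up costs at most 1, and the change of base costs a factor
  \<open>1 / ln 2 \<le> 2\<close>.\<close>

lemma depth_le_ln:
  assumes "1 \<le> k" "k \<le> n"
  shows "real (depth n k) \<le> 2 * (1 + ln (real n / real k))"
proof -
  have "1 \<le> real n / real k"
    using assms by simp
  then have ln_nonneg: "0 \<le> ln (real n / real k)"
    by simp
  have "real (depth n k) \<le> 1 + log 2 (real n / real k)"
    unfolding depth_def using assms \<open>1 \<le> real n / real k\<close>
    by (simp add: of_nat_nat) linarith
  also have "log 2 (real n / real k) \<le> 2 * ln (real n / real k)"
  proof -
    \<comment> \<open>This is \<open>ln x \<le> x - 1\<close> at \<open>x = 1 / 2\<close>.\<close>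
    have "1 / 2 \<le> ln (2::real)"
      using ln_le_minus_one[of "1 / 2"] by (simp add: ln_div)
    then have "ln (real n / real k) * 1 \<le> ln (real n / real k) * (2 * ln 2)"
      using ln_nonneg by (intro mult_left_mono) auto
    then show ?thesis
      by (simp add: log_def divide_le_eq mult_ac)
  qed
  finally show ?thesis
    by simp
qed

theorem theorem3p4:
  shows "\<exists>(alg :: 'a set \<Rightarrow> ('a \<Rightarrow> real) \<Rightarrow> nat \<Rightarrow> 'a query_alg) (C :: real) (c :: nat).
    C > 0 \<and>
    (\<forall>V w d k. weighted_metric_space V w d \<longrightarrow> 1 \<le> k \<longrightarrow> k \<le> card V \<longrightarrow>
       approximates_k_median C V w d k (run d (alg V w k)) \<and>
       set (queries d (alg V w k)) \<subseteq> V \<times> V \<and>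
       real (length (queries d (alg V w k))) \<le> soft_nk_bound C c V d k)"
proof -
  define alg :: "'a set \<Rightarrow> ('a \<Rightarrow> real) \<Rightarrow> nat \<Rightarrow> 'a query_alg" where
    "alg = (\<lambda>V w k. solve w k (depth (card V) k) (SOME xs. set xs = V \<and> distinct xs))"
  \<comment> \<open>The constant 4 is the loss 2 per level times the factor 2 of
    \<open>depth_le_ln\<close>. The query count, \<open>2 * n * k\<close> per level, gives the same
    4 with a single logarithmic factor, hence exponent 1.\<close>
  have "approximates_k_median 4 V w d k (run d (alg V w k)) \<and>
      set (queries d (alg V w k)) \<subseteq> V \<times> V \<and>
      real (length (queries d (alg V w k))) \<le> soft_nk_bound 4 1 V d k"
    if space: "weighted_metric_space V w d" and k: "1 \<le> k" "k \<le> card V"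
    for V :: "'a set" and w d k
  proof -
    interpret weighted_metric_space V w d
      by (rule space)
    define n where "n = card V"
    define j where "j = depth n k"
    define xs where "xs = (SOME xs. set xs = V \<and> distinct xs)"
    have xs: "set xs = V" "distinct xs"
      using finite_distinct_list[OF finite_space] unfolding xs_def
      by (metis (mono_tags, lifting) someI_ex)+
    then have len: "length xs = n"
      using distinct_card[of xs] by (simp add: n_def)
    have alg: "alg V w k = solve w k j xs"
      by (simp add: alg_def j_def n_def xs_def)
    obtain R where R: "R \<in> center_sets k V" "OPT w d k V = cost w d R V"
      using OPT_attained[OF k] .
    have "xs \<noteq> []" "length xs \<le> k * 2 ^ j"
      using k len le_mult_power_depth[of k n] by (auto simp: n_def j_def)
    then have sol: "run d (alg V w k) \<in> center_sets k V"
        "cost w d (run d (alg V w k)) V \<le> 2 * real j * cost w d R V"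
        "set (queries d (alg V w k)) \<subseteq> V \<times> V"
        "length (queries d (alg V w k)) \<le> 2 * j * n * k"
      using solve_correct[OF k(1) xs(2) _ _ _ R(1), of j] xs(1) unfolding alg len by auto
    have j: "2 * real j \<le> 4 * (1 + ln (real n / real k))"
      using depth_le_ln[of k n] k by (simp add: j_def n_def)
    have "0 \<le> cost w d R V"
      using R(1) finite_space finite_subset by (intro cost_nonneg) (auto simp: center_sets_def)
    then have "cost w d (run d (alg V w k)) V
        \<le> 4 * (1 + ln (real n / real k)) * cost w d R V"
      using sol(2) mult_right_mono[OF j] by (meson order_trans)
    moreover have "real (length (queries d (alg V w k)))
        \<le> 4 * real n * real k * (1 + ln (real n) + ln (aspect_ratio V d))"
    proof -
      \<comment> \<open>The factor \<open>1 + ln (n / k)\<close> is enlarged to the polylogarithmic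
        form, using \<open>k \<ge> 1\<close> and that the aspect ratio is at least 1.\<close>
      have "ln (real n / real k) \<le> ln (real n)"
        using k by (simp add: ln_div n_def)
      moreover have "0 \<le> ln (aspect_ratio V d)"
        using aspect_ratio_ge_1 by simp
      ultimately have "4 * (1 + ln (real n / real k))
          \<le> 4 * (1 + ln (real n) + ln (aspect_ratio V d))"
        by (intro mult_left_mono) auto
      then have "2 * real j \<le> 4 * (1 + ln (real n) + ln (aspect_ratio V d))"
        using j by (rule order_trans[rotated])
      then have "2 * real j * (real n * real k)
          \<le> 4 * (1 + ln (real n) + ln (aspect_ratio V d)) * (real n * real k)"
        by (rule mult_right_mono) simp
      moreover have "real (length (queries d (alg V w k))) \<le> real (2 * j * n * k)"
        using sol(4) by (rule of_nat_mono)
      ultimately show ?thesis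
        by (simp add: mult_ac)
    qed
    ultimately show ?thesis
      using sol(1,3) R(2)
      by (simp add: approximates_k_median_def soft_nk_bound_def center_sets_def flip: n_def)
  qed
  then show ?thesis
    by (intro exI[of _ alg] exI[of _ "4 :: real"] exI[of _ "1 :: nat"]) simp
qed

end
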